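(* For all $h,k\ge2$, the monoids $M_{h,1}$ and $\mathsf{plep}M_{h,1}$ are not embeddable into $\mathsf{tot}M_{k,1}$; that is, there is no injective monoid homomorphism $M_{h,1}\to\mathsf{tot}M_{k,1}$ and no injective monoid homomorphism $\mathsf{plep}M_{h,1}\to\mathsf{tot}M_{k,1}$.
   Context: For an alphabet $A$ with $|A|=k$: a prefix code in $A^*$ is a set of strings none of which is a proper prefix of another. A right-ideal morphism of $A^*$ is a partial function $f:A^*\to A^*$ whose domain is a right ideal (a set $R$ with $R=RA^*$) and such that $f(xu)=f(x)u$ for all $x\in\mathrm{Dom}(f)$, $u\in A^*$; $\mathrm{domC}(f)$ is the unique prefix code with $\mathrm{Dom}(f)=\mathrm{domC}(f)A^*$. $\mathcal{RM}_k^{\mathsf{fin}}$ is the monoid under composition of all right-ideal morphisms of $A^*$ with finite domain code (including the empty function). $f\equiv_{\rm fin}g$ iff the symmetric difference of $\mathrm{Dom}(f)$ and $\mathrm{Dom}(g)$ is finite and $f,g$ agree on $\mathrm{Dom}(f)\cap\mathrm{Dom}(g)$; this is a congruence. $M_{k,1}=\mathcal{RM}_k^{\mathsf{fin}}/\!\equiv_{\rm fin}$; it acts faithfully on $A^\omega$ by partial functions $f(xz)=f(x)z$ ($x\in\mathrm{Dom}(f)$, $z\in A^\omega$). $\mathsf{tot}M_{k,1}$ is the submonoid of those elements represented by $f$ with $\mathrm{domC}(f)$ a maximal prefix code, i.e. acting as total functions on $A^\omega$. $\mathsf{plep}M_{k,1}$ is the submonoid of those elements represented by some $f\in\mathcal{RM}_k^{\mathsf{fin}}$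 such that for all $x_1,x_2\in\mathrm{Dom}(f)$: $|x_1|=|x_2|$ implies $|f(x_1)|=|f(x_2)|$. *)

theory Defs
  imports "HOL-Algebra.Group" "HOL-Library.Sublist"
begin

text \<open>
  Words over an alphabet \<open>A\<close> are the elements of \<open>lists A\<close>; partial functions on words are
  maps \<open>'a list \<rightharpoonup> 'a list\<close>, composed by \<open>(\<circ>\<^sub>m)\<close> with the right factor applied first.
\<close>

definition prefix_code :: "'a set \<Rightarrow> 'a list set \<Rightarrow> bool" where
  "prefix_code A P \<longleftrightarrow> P \<subseteq> lists A \<and> (\<forall>x\<in>P. \<forall>y\<in>P. \<not> strict_prefix x y)"

definition maximal_prefix_code :: "'a set \<Rightarrow> 'a list set \<Rightarrow> bool" where
  "maximal_prefix_code A P \<longleftrightarrow>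
     prefix_code A P \<and> (\<forall>Q. prefix_code A Q \<and> P \<subseteq> Q \<longrightarrow> Q = P)"

definition right_mult :: "'a set \<Rightarrow> 'a list set \<Rightarrow> 'a list set" where
  "right_mult A P = {x @ u | x u. x \<in> P \<and> u \<in> lists A}"

definition right_ideal :: "'a set \<Rightarrow> 'a list set \<Rightarrow> bool" where
  "right_ideal A R \<longleftrightarrow> R \<subseteq> lists A \<and> R = right_mult A R"

definition right_ideal_morphism :: "'a set \<Rightarrow> ('a list \<rightharpoonup> 'a list) \<Rightarrow> bool" where
  "right_ideal_morphism A f \<longleftrightarrow>
     right_ideal A (dom f) \<and> ran f \<subseteq> lists A \<and>
     (\<forall>x\<in>dom f. \<forall>u\<in>lists A. the (f (x @ u)) = the (f x) @ u)"

definition domC :: "'a set \<Rightarrow> ('a list \<rightharpoonup> 'a list) \<Rightarrow> 'a list set" where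
  "domC A f = (THE P. prefix_code A P \<and> dom f = right_mult A P)"

definition RM_fin :: "'a set \<Rightarrow> ('a list \<rightharpoonup> 'a list) set" where
  "RM_fin A = {f. right_ideal_morphism A f \<and> finite (domC A f)}"

definition fin_equiv :: "'a set \<Rightarrow> (('a list \<rightharpoonup> 'a list) \<times> ('a list \<rightharpoonup> 'a list)) set" where
  "fin_equiv A = {(f, g). f \<in> RM_fin A \<and> g \<in> RM_fin A \<and>
     finite (sym_diff (dom f) (dom g)) \<and> (\<forall>x\<in>dom f \<inter> dom g. f x = g x)}"

text \<open>
  The product of two classes is the class of the composite of any representatives; the union
  below ranges over equal classes, by \<open>fin_equiv_congruent2\<close>.
\<close>

definition M1 :: "'a set \<Rightarrow> ('a list \<rightharpoonup> 'a list) set monoid" where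
  "M1 A = \<lparr>carrier = RM_fin A // fin_equiv A,
           mult = (\<lambda>X Y. \<Union>f\<in>X. \<Union>g\<in>Y. fin_equiv A `` {f \<circ>\<^sub>m g}),
           one = fin_equiv A `` {Some |` lists A}\<rparr>"

definition tot_carrier :: "'a set \<Rightarrow> ('a list \<rightharpoonup> 'a list) set set" where
  "tot_carrier A = {X \<in> carrier (M1 A). \<exists>f\<in>X. maximal_prefix_code A (domC A f)}"

definition totM1 :: "'a set \<Rightarrow> ('a list \<rightharpoonup> 'a list) set monoid" where
  "totM1 A = (M1 A)\<lparr>carrier := tot_carrier A\<rparr>"

definition plep :: "('a list \<rightharpoonup> 'a list) \<Rightarrow> bool" where
  "plep f \<longleftrightarrow> (\<forall>x\<^sub>1\<in>dom f. \<forall>x\<^sub>2\<in>dom f.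
     length x\<^sub>1 = length x\<^sub>2 \<longrightarrow> length (the (f x\<^sub>1)) = length (the (f x\<^sub>2)))"

definition plep_carrier :: "'a set \<Rightarrow> ('a list \<rightharpoonup> 'a list) set set" where
  "plep_carrier A = {X \<in> carrier (M1 A). \<exists>f\<in>X. plep f}"

definition plepM1 :: "'a set \<Rightarrow> ('a list \<rightharpoonup> 'a list) set monoid" where
  "plepM1 A = (M1 A)\<lparr>carrier := plep_carrier A\<rparr>"

lemma right_ideal_append: "right_ideal A R \<Longrightarrow> x \<in> R \<Longrightarrow> u \<in> lists A \<Longrightarrow> x @ u \<in> R"
  unfolding right_ideal_def right_mult_def by blast

lemma subset_right_mult: "R \<subseteq> right_mult A R"
proof
  fix x assume "x \<in> R"
  then have "x = x @ [] \<and> x \<in> R \<and> [] \<in> lists A" by simp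
  then show "x \<in> right_mult A R" unfolding right_mult_def by blast
qed

lemma right_idealI:
  assumes "R \<subseteq> lists A" "\<And>x u. x \<in> R \<Longrightarrow> u \<in> lists A \<Longrightarrow> x @ u \<in> R"
  shows "right_ideal A R"
  unfolding right_ideal_def
proof
  have "right_mult A R \<subseteq> R" unfolding right_mult_def using assms(2) by blast
  then show "R = right_mult A R" using subset_right_mult by blast
qed (rule assms(1))

lemma right_ideal_code:
  assumes R: "right_ideal A R"
  shows "prefix_code A {x \<in> R. \<forall>y\<in>R. \<not> strict_prefix y x} \<and>
         R = right_mult A {x \<in> R. \<forall>y\<in>R. \<not> strict_prefix y x}" (is "prefix_code A ?P \<and> _")
proof
  show "prefix_code A ?P"
    using R unfolding prefix_code_def right_ideal_def by blast
  have "\<exists>p\<in>?P. prefix p x" if "x \<in> R" for x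
    using that
  proof (induction x rule: length_induct)
    case (1 x)
    show ?case
    proof (cases "x \<in> ?P")
      case False
      then obtain y where "y \<in> R" "strict_prefix y x" using 1(2) by blast
      then show ?thesis
        using 1(1) by (meson prefix_length_less prefix_order.less_imp_le prefix_order.trans)
    qed auto
  qed
  then have "R \<subseteq> right_mult A ?P"
    using R unfolding right_mult_def right_ideal_def prefix_def
    by (smt (verit) append_in_lists_conv mem_Collect_eq subsetD subsetI)
  moreover have "right_mult A ?P \<subseteq> R"
    using right_ideal_append[OF R] unfolding right_mult_def by blast
  ultimately show "R = right_mult A ?P" by blast
qed

lemma prefix_code_unique:
  assumes P: "prefix_code A P" and Q: "prefix_code A Q" and eq: "right_mult A P = right_mult A Q"
  shows "P = Q"
proof -
  have *: "P' \<subseteq> Q'"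
    if P': "prefix_code A P'" and Q': "prefix_code A Q'" and eq': "right_mult A P' = right_mult A Q'"
    for P' Q'
  proof
    fix x assume x: "x \<in> P'"
    have sub: "\<exists>t\<in>T. prefix t z" if "right_mult A S = right_mult A T" "z \<in> S" for z S T
    proof -
      have "z \<in> right_mult A T" using that subset_right_mult by blast
      then show ?thesis unfolding right_mult_def prefix_def by blast
    qed
    obtain q where q: "q \<in> Q'" "prefix q x" using sub[OF eq' x] by blast
    obtain p where p: "p \<in> P'" "prefix p q" using sub[OF eq'[symmetric] q(1)] by blast
    have "p = x"
      using P' x p q unfolding prefix_code_def
      by (meson prefix_order.le_imp_less_or_eq prefix_order.trans)
    then show "x \<in> Q'" using p q prefix_order.antisym by blast
  qed
  show ?thesis using *[OF P Q eq] *[OF Q P eq[symmetric]] by blast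
qed

lemma domC_eqI: "prefix_code A P \<Longrightarrow> dom f = right_mult A P \<Longrightarrow> domC A f = P"
  unfolding domC_def by (rule the_equality) (auto dest: prefix_code_unique)

lemma domC_eq: "right_ideal A (dom f) \<Longrightarrow> domC A f = {x \<in> dom f. \<forall>y\<in>dom f. \<not> strict_prefix y x}"
  by (rule domC_eqI[OF conjunct1[OF right_ideal_code] conjunct2[OF right_ideal_code]])

lemma domC_properties:
  assumes "right_ideal A (dom f)"
  shows "prefix_code A (domC A f)" "dom f = right_mult A (domC A f)"
  using right_ideal_code[OF assms] unfolding domC_eq[OF assms] by auto

lemma finite_domC_iff:
  assumes A: "finite A" and R: "right_ideal A (dom f)"
  shows "finite (domC A f) \<longleftrightarrow> (\<exists>N. \<forall>x\<in>dom f. take N x \<in> dom f)"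
proof
  assume fin: "finite (domC A f)"
  define N where "N = Max (insert 0 (length ` domC A f))"
  have N: "length p \<le> N" if "p \<in> domC A f" for p
    using that fin unfolding N_def by auto
  have "take N x \<in> dom f" if x: "x \<in> dom f" for x
  proof -
    obtain p u where pu: "x = p @ u" "p \<in> domC A f" "u \<in> lists A"
      using x domC_properties(2)[OF R] unfolding right_mult_def by blast
    have "take N x = p @ take (N - length p) u" using pu N by simp
    moreover have "take (N - length p) u \<in> lists A" using pu(3) by (auto dest: in_set_takeD)
    ultimately show ?thesis
      using pu domC_properties(2)[OF R] unfolding right_mult_def by blast
  qed
  then show "\<exists>N. \<forall>x\<in>dom f. take N x \<in> dom f" by blast
next
  assume "\<exists>N. \<forall>x\<in>dom f. take N x \<in> dom f"
  then obtain N where N: "\<And>x. x \<in> dom f \<Longrightarrow> take N x \<in> dom f" by blast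
  have "domC A f \<subseteq> {x. set x \<subseteq> A \<and> length x \<le> N}"
  proof
    fix x assume x: "x \<in> domC A f"
    then have "x \<in> dom f" "\<not> strict_prefix (take N x) x" "x \<in> lists A"
      using N R unfolding domC_eq[OF R] right_ideal_def by auto
    then have "take N x = x" by (metis prefix_order.le_imp_less_or_eq take_is_prefix)
    then show "x \<in> {x. set x \<subseteq> A \<and> length x \<le> N}"
      using \<open>x \<in> lists A\<close> by (metis in_listsD mem_Collect_eq nle_le subsetI take_all_iff)
  qed
  then show "finite (domC A f)" using finite_lists_length_le[OF A] finite_subset by blast
qed

lemma RM_fin_iff:
  assumes "finite A"
  shows "f \<in> RM_fin A \<longleftrightarrow> dom f \<subseteq> lists A \<and> ran f \<subseteq> lists A \<and>
    (\<forall>x y u. f x = Some y \<and> u \<in> lists A \<longrightarrow> f (x @ u) = Some (y @ u)) \<and>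
    (\<exists>N. \<forall>x\<in>dom f. take N x \<in> dom f)" (is "?L \<longleftrightarrow> ?R")
proof
  assume L: ?L
  then have r: "right_ideal A (dom f)" unfolding RM_fin_def right_ideal_morphism_def by auto
  have "f (x @ u) = Some (y @ u)" if "f x = Some y" "u \<in> lists A" for x y u
  proof -
    have "x \<in> dom f" using that by auto
    then have "x @ u \<in> dom f" "the (f (x @ u)) = y @ u"
      using L that right_ideal_append[OF r] unfolding RM_fin_def right_ideal_morphism_def by auto
    then show ?thesis by auto
  qed
  then show ?R
    using L r finite_domC_iff[OF assms r]
    unfolding RM_fin_def right_ideal_morphism_def right_ideal_def by blast
next
  assume R: ?R
  then have r: "right_ideal A (dom f)" by (intro right_idealI) blast+
  have "the (f (x @ u)) = the (f x) @ u" if "x \<in> dom f" "u \<in> lists A" for x u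
    using R that by fastforce
  then show ?L
    using R r finite_domC_iff[OF assms r] unfolding RM_fin_def right_ideal_morphism_def by blast
qed

lemma RM_fin_append:
  "finite A \<Longrightarrow> f \<in> RM_fin A \<Longrightarrow> f x = Some y \<Longrightarrow> u \<in> lists A \<Longrightarrow> f (x @ u) = Some (y @ u)"
  by (simp add: RM_fin_iff)

lemma RM_fin_lists:
  assumes "finite A" "f \<in> RM_fin A" "f x = Some y"
  shows "x \<in> lists A" "y \<in> lists A"
  using assms by (auto simp: RM_fin_iff dom_def ran_def)

lemma RM_fin_length:
  assumes A: "finite A" and f: "f \<in> RM_fin A"
  shows "\<exists>N. \<forall>x y. f x = Some y \<longrightarrow> take N x \<in> dom f \<and> length x \<le> N + length y"
proof -
  obtain N where N: "\<And>x. x \<in> dom f \<Longrightarrow> take N x \<in> dom f"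
    using f unfolding RM_fin_iff[OF A] by blast
  have "length x \<le> N + length y" if xy: "f x = Some y" for x y
  proof -
    obtain z where z: "f (take N x) = Some z" using N xy by blast
    have "drop N x \<in> lists A" using RM_fin_lists[OF A f xy] by (auto dest: in_set_dropD)
    then have "f (take N x @ drop N x) = Some (z @ drop N x)" using RM_fin_append[OF A f z] by blast
    then have "y = z @ drop N x" using xy by simp
    then show ?thesis by simp
  qed
  then show ?thesis using N by blast
qed

lemma RM_fin_id:
  assumes "finite A"
  shows "Some |` lists A \<in> RM_fin A"
  unfolding RM_fin_iff[OF assms]
  by (auto simp: restrict_map_def ran_def split: if_splits intro: exI[of _ 0])

lemma RM_fin_comp:
  assumes A: "finite A" and f: "f \<in> RM_fin A" and g: "g \<in> RM_fin A"
  shows "f \<circ>\<^sub>m g \<in> RM_fin A"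
proof -
  obtain N where N: "\<And>x y. g x = Some y \<Longrightarrow> take N x \<in> dom g"
    using RM_fin_length[OF A g] by blast
  obtain M where M: "\<And>x y. f x = Some y \<Longrightarrow> take M x \<in> dom f"
    using RM_fin_length[OF A f] by blast
  have "take (N + M) x \<in> dom (f \<circ>\<^sub>m g)" if x: "x \<in> dom (f \<circ>\<^sub>m g)" for x
  proof -
    obtain y w where y: "g x = Some y" and w: "f y = Some w"
      using x by (auto simp: map_comp_def split: option.splits)
    obtain z where z: "g (take N x) = Some z" using N[OF y] by blast
    have L: "drop N x \<in> lists A" "take M (drop N x) \<in> lists A"
      using RM_fin_lists(1)[OF A g y] by (auto dest: in_set_dropD in_set_takeD)
    have y_eq: "y = z @ drop N x" using RM_fin_append[OF A g z L(1)] y by simp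
    have gx: "g (take (N + M) x) = Some (z @ take M (drop N x))"
      using RM_fin_append[OF A g z L(2)] by (simp add: take_add)
    obtain v where v: "f (take M y) = Some v" using M[OF w] by blast
    have "z @ take M (drop N x) = take M y @ drop M (z @ take M (drop N x))"
    proof -
      have "take M (z @ take M (drop N x)) = take M y" unfolding y_eq by (simp add: min_def)
      then show ?thesis using append_take_drop_id[of M "z @ take M (drop N x)"] by simp
    qed
    moreover have "drop M (z @ take M (drop N x)) \<in> lists A"
      using RM_fin_lists(2)[OF A g gx] by (auto dest: in_set_dropD)
    ultimately have "z @ take M (drop N x) \<in> dom f"
      using RM_fin_append[OF A f v] by (metis domI)
    then show ?thesis using gx by (auto simp: map_comp_def)
  qed
  moreover have "dom (f \<circ>\<^sub>m g) \<subseteq> lists A" "ran (f \<circ>\<^sub>m g) \<subseteq> lists A"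
    using RM_fin_lists[OF A f] RM_fin_lists[OF A g]
    by (auto simp: map_comp_def ran_def dom_def split: option.splits) blast+
  moreover have "(f \<circ>\<^sub>m g) (x @ u) = Some (y @ u)" if fg: "(f \<circ>\<^sub>m g) x = Some y" and u: "u \<in> lists A" for x y u
  proof -
    obtain z where z: "g x = Some z" "f z = Some y"
      using fg map_comp_Some_iff[of f g x y] by blast
    show ?thesis
      using RM_fin_append[OF A g z(1) u] RM_fin_append[OF A f z(2) u]
      by (simp add: map_comp_def)
  qed
  ultimately show ?thesis unfolding RM_fin_iff[OF A] by blast
qed

lemma fin_equiv_iff:
  assumes A: "finite A"
  shows "(f, g) \<in> fin_equiv A \<longleftrightarrow> f \<in> RM_fin A \<and> g \<in> RM_fin A \<and>
    (\<exists>N. \<forall>x. N \<le> length x \<longrightarrow> f x = g x)" (is "?L \<longleftrightarrow> ?R")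
proof
  assume L: ?L
  let ?D = "sym_diff (dom f) (dom g)"
  have fin: "finite ?D" using L unfolding fin_equiv_def by blast
  have "f x = g x" if "Suc (Max (insert 0 (length ` ?D))) \<le> length x" for x
  proof -
    have "x \<notin> ?D"
    proof
      assume "x \<in> ?D"
      then have "length x \<le> Max (insert 0 (length ` ?D))" using fin by (intro Max_ge) auto
      with that show False by simp
    qed
    then have "x \<in> dom f \<longleftrightarrow> x \<in> dom g" by blast
    moreover have "f x = g x" if "x \<in> dom f \<inter> dom g"
      using L that unfolding fin_equiv_def by blast
    ultimately show ?thesis by (metis IntI domIff)
  qed
  then show ?R using L unfolding fin_equiv_def by blast
next
  assume R: ?R
  then have f: "f \<in> RM_fin A" and g: "g \<in> RM_fin A" by auto
  obtain N where N: "\<And>x. N \<le> length x \<Longrightarrow> f x = g x" using R by blast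
  have "sym_diff (dom f) (dom g) \<subseteq> {x. set x \<subseteq> A \<and> length x \<le> N}"
  proof
    fix x assume x: "x \<in> sym_diff (dom f) (dom g)"
    then have "x \<in> lists A" using RM_fin_lists(1)[OF A f] RM_fin_lists(1)[OF A g] by blast
    moreover have "\<not> N \<le> length x" using x N[of x] by (auto simp: domIff)
    ultimately show "x \<in> {x. set x \<subseteq> A \<and> length x \<le> N}" by auto
  qed
  then have "finite (sym_diff (dom f) (dom g))"
    using finite_lists_length_le[OF A] finite_subset by blast
  moreover have "f x = g x" if "x \<in> dom f \<inter> dom g" for x
  proof (cases "A = {}")
    case True
    obtain y z where "f x = Some y" "g x = Some z" using \<open>x \<in> dom f \<inter> dom g\<close> by auto
    then show ?thesis using RM_fin_lists[OF A f] RM_fin_lists[OF A g] True by force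
  next
    case False
    then obtain a where a: "a \<in> A" by blast
    obtain y z where yz: "f x = Some y" "g x = Some z" using \<open>x \<in> dom f \<inter> dom g\<close> by auto
    have u: "replicate N a \<in> lists A" using a by auto
    have "f (x @ replicate N a) = g (x @ replicate N a)" by (rule N) simp
    then show ?thesis
      using RM_fin_append[OF A f yz(1) u] RM_fin_append[OF A g yz(2) u] yz by simp
  qed
  ultimately show ?L using f g unfolding fin_equiv_def by blast
qed

lemma equiv_fin_equiv:
  assumes A: "finite A"
  shows "equiv (RM_fin A) (fin_equiv A)"
proof (rule equivI)
  show "fin_equiv A \<subseteq> RM_fin A \<times> RM_fin A" unfolding fin_equiv_def by blast
  show "refl_on (RM_fin A) (fin_equiv A)" unfolding refl_on_def fin_equiv_iff[OF A] by blast
  show "sym (fin_equiv A)" unfolding sym_def fin_equiv_iff[OF A] by metis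
  show "trans (fin_equiv A)"
  proof (rule transI)
    fix f g h assume fg: "(f, g) \<in> fin_equiv A" and gh: "(g, h) \<in> fin_equiv A"
    obtain N where "\<And>x. N \<le> length x \<Longrightarrow> f x = g x" using fg fin_equiv_iff[OF A] by blast
    moreover obtain M where "\<And>x. M \<le> length x \<Longrightarrow> g x = h x" using gh fin_equiv_iff[OF A] by blast
    ultimately have "\<forall>x. max N M \<le> length x \<longrightarrow> f x = h x" by simp
    then show "(f, h) \<in> fin_equiv A" using fg gh unfolding fin_equiv_iff[OF A] by blast
  qed
qed

lemma fin_equiv_comp:
  assumes A: "finite A" and ff': "(f, f') \<in> fin_equiv A" and gg': "(g, g') \<in> fin_equiv A"
  shows "(f \<circ>\<^sub>m g, f' \<circ>\<^sub>m g') \<in> fin_equiv A"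
proof -
  have RM: "f \<in> RM_fin A" "f' \<in> RM_fin A" "g \<in> RM_fin A" "g' \<in> RM_fin A"
    using ff' gg' unfolding fin_equiv_def by auto
  obtain N where N: "\<And>x. N \<le> length x \<Longrightarrow> f x = f' x" using ff' fin_equiv_iff[OF A] by blast
  obtain M where M: "\<And>x. M \<le> length x \<Longrightarrow> g x = g' x" using gg' fin_equiv_iff[OF A] by blast
  obtain L where L: "\<And>x y. g x = Some y \<Longrightarrow> length x \<le> L + length y"
    using RM_fin_length[OF A RM(3)] by blast
  have "(f \<circ>\<^sub>m g) x = (f' \<circ>\<^sub>m g') x" if "M + L + N \<le> length x" for x
  proof (cases "g x")
    case None
    then show ?thesis using that M[of x] by (simp add: map_comp_def)
  next
    case (Some y)
    then have "N \<le> length y" using that L[OF Some] by simp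
    then show ?thesis using Some that M[of x] N[of y] by (simp add: map_comp_def)
  qed
  then show ?thesis
    using RM_fin_comp[OF A RM(1,3)] RM_fin_comp[OF A RM(2,4)] unfolding fin_equiv_iff[OF A] by blast
qed

lemma fin_equiv_congruent2:
  assumes A: "finite A"
  shows "congruent2 (fin_equiv A) (fin_equiv A) (\<lambda>f g. fin_equiv A `` {f \<circ>\<^sub>m g})"
  by (rule congruent2I') (rule equiv_class_eq[OF equiv_fin_equiv[OF A] fin_equiv_comp[OF A]])

lemma M1_mult:
  assumes A: "finite A" and f: "f \<in> RM_fin A" and g: "g \<in> RM_fin A"
  shows "fin_equiv A `` {f} \<otimes>\<^bsub>M1 A\<^esub> fin_equiv A `` {g} = fin_equiv A `` {f \<circ>\<^sub>m g}"
  unfolding M1_def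
  using UN_equiv_class2[OF equiv_fin_equiv[OF A] equiv_fin_equiv[OF A] fin_equiv_congruent2[OF A] f g]
  by simp

lemma map_comp_assoc: "(f \<circ>\<^sub>m g) \<circ>\<^sub>m h = f \<circ>\<^sub>m (g \<circ>\<^sub>m h)"
  by (rule ext) (simp add: map_comp_def split: option.splits)

lemma RM_fin_id_comp:
  assumes A: "finite A" and f: "f \<in> RM_fin A"
  shows "(Some |` lists A) \<circ>\<^sub>m f = f" "f \<circ>\<^sub>m (Some |` lists A) = f"
proof -
  show "(Some |` lists A) \<circ>\<^sub>m f = f"
  proof
    fix x show "((Some |` lists A) \<circ>\<^sub>m f) x = f x"
      using RM_fin_lists(2)[OF A f, of x] by (cases "f x") (simp_all add: map_comp_def)
  qed
  show "f \<circ>\<^sub>m (Some |` lists A) = f"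
  proof
    fix x show "(f \<circ>\<^sub>m (Some |` lists A)) x = f x"
      using RM_fin_lists(1)[OF A f, of x]
      by (cases "x \<in> lists A"; cases "f x") (simp_all add: map_comp_def)
  qed
qed

lemma monoid_M1:
  assumes A: "finite A"
  shows "monoid (M1 A)"
proof -
  have carr: "X \<in> carrier (M1 A) \<longleftrightarrow> (\<exists>f\<in>RM_fin A. X = fin_equiv A `` {f})" for X
    unfolding M1_def quotient_def by auto
  have one: "\<one>\<^bsub>M1 A\<^esub> = fin_equiv A `` {Some |` lists A}" unfolding M1_def by simp
  note mult = M1_mult[OF A] and comp = RM_fin_comp[OF A] and id = RM_fin_id[OF A]
  show ?thesis
  proof (rule monoidI)
    show "\<one>\<^bsub>M1 A\<^esub> \<in> carrier (M1 A)" unfolding carr one using id by blast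
  next
    fix X Y assume "X \<in> carrier (M1 A)" "Y \<in> carrier (M1 A)"
    then show "X \<otimes>\<^bsub>M1 A\<^esub> Y \<in> carrier (M1 A)" unfolding carr using mult comp by metis
  next
    fix X Y Z assume "X \<in> carrier (M1 A)" "Y \<in> carrier (M1 A)" "Z \<in> carrier (M1 A)"
    then obtain f g h where "f \<in> RM_fin A" "g \<in> RM_fin A" "h \<in> RM_fin A"
      "X = fin_equiv A `` {f}" "Y = fin_equiv A `` {g}" "Z = fin_equiv A `` {h}"
      unfolding carr by blast
    then show "X \<otimes>\<^bsub>M1 A\<^esub> Y \<otimes>\<^bsub>M1 A\<^esub> Z = X \<otimes>\<^bsub>M1 A\<^esub> (Y \<otimes>\<^bsub>M1 A\<^esub> Z)"
      by (simp add: mult comp map_comp_assoc)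
  next
    fix X assume "X \<in> carrier (M1 A)"
    then show "\<one>\<^bsub>M1 A\<^esub> \<otimes>\<^bsub>M1 A\<^esub> X = X" "X \<otimes>\<^bsub>M1 A\<^esub> \<one>\<^bsub>M1 A\<^esub> = X"
      unfolding carr one using mult[OF id] mult[OF _ id] RM_fin_id_comp[OF A] by auto
  qed
qed

lemma tot_iff:
  assumes A: "finite A" "A \<noteq> {}" and f: "f \<in> RM_fin A"
  shows "maximal_prefix_code A (domC A f) \<longleftrightarrow> (\<exists>N. \<forall>x\<in>lists A. N \<le> length x \<longrightarrow> x \<in> dom f)"
proof
  have r: "right_ideal A (dom f)" and fin: "finite (domC A f)"
    using f unfolding RM_fin_def right_ideal_morphism_def by auto
  note pc = domC_properties[OF r]
  {
    assume m: "maximal_prefix_code A (domC A f)"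
    define N where "N = Max (insert 0 (length ` domC A f))"
    have N: "length p \<le> N" if "p \<in> domC A f" for p
      using that fin unfolding N_def by auto
    have "x \<in> dom f" if x: "x \<in> lists A" "N \<le> length x" for x
    proof (rule ccontr)
      assume nx: "x \<notin> dom f"
      have "\<not> prefix p x" if p: "p \<in> domC A f" for p
      proof
        assume "prefix p x"
        then obtain u where "x = p @ u" by (auto simp: prefix_def)
        then show False using nx x p pc(2) unfolding right_mult_def by auto
      qed
      moreover have "\<not> strict_prefix x p" if p: "p \<in> domC A f" for p
        using N[OF p] x(2) prefix_length_less[of x p] by auto
      ultimately have "prefix_code A (insert x (domC A f))"
        using pc(1) x(1) prefix_order.less_imp_le unfolding prefix_code_def by blast
      then have "x \<in> domC A f" using m unfolding maximal_prefix_code_def by blast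
      then show False using nx pc(2) subset_right_mult by blast
    qed
    then show "\<exists>N. \<forall>x\<in>lists A. N \<le> length x \<longrightarrow> x \<in> dom f" by blast
  next
    assume "\<exists>N. \<forall>x\<in>lists A. N \<le> length x \<longrightarrow> x \<in> dom f"
    then obtain N where N: "\<And>x. x \<in> lists A \<Longrightarrow> N \<le> length x \<Longrightarrow> x \<in> dom f" by blast
    obtain a where a: "a \<in> A" using A by blast
    have "q \<in> domC A f" if Q: "prefix_code A Q" "domC A f \<subseteq> Q" and q: "q \<in> Q" for Q q
    proof -
      have "q @ replicate N a \<in> lists A" using Q(1) q a unfolding prefix_code_def by auto
      then have "q @ replicate N a \<in> dom f" by (rule N) simp
      then obtain p u where p: "p \<in> domC A f" "q @ replicate N a = p @ u"
        using pc(2) unfolding right_mult_def by auto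
      have "prefix p (q @ replicate N a)" "prefix q (q @ replicate N a)" using p(2) unfolding prefix_def by blast+
      then have "prefix p q \<or> prefix q p" using prefix_same_cases by blast
      then have "p = q"
        using Q q p(1) unfolding prefix_code_def by (metis strict_prefixI subsetD)
      then show ?thesis using p by simp
    qed
    then show "maximal_prefix_code A (domC A f)"
      using pc(1) unfolding maximal_prefix_code_def by blast
  }
qed

lemma M1_submonoidI:
  assumes A: "finite A"
    and one: "P (Some |` lists A)"
    and comp: "\<And>f g. f \<in> RM_fin A \<Longrightarrow> g \<in> RM_fin A \<Longrightarrow> P f \<Longrightarrow> P g \<Longrightarrow> P (f \<circ>\<^sub>m g)"
  shows "submonoid {X \<in> carrier (M1 A). \<exists>f\<in>X. P f} (M1 A)"
proof
  note eq = equiv_fin_equiv[OF A] and id = RM_fin_id[OF A]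
  have rep: "\<exists>f\<in>RM_fin A. P f \<and> X = fin_equiv A `` {f}"
    if X: "X \<in> {X \<in> carrier (M1 A). \<exists>f\<in>X. P f}" for X
  proof -
    obtain f g where f: "f \<in> X" "P f" and g: "X = fin_equiv A `` {g}"
      using X unfolding M1_def quotient_def by auto
    then have "(g, f) \<in> fin_equiv A" by blast
    then have "f \<in> RM_fin A" "X = fin_equiv A `` {f}"
      using g equiv_class_eq[OF eq] unfolding fin_equiv_def by auto
    then show ?thesis using f(2) by blast
  qed
  have cls: "fin_equiv A `` {f} \<in> {X \<in> carrier (M1 A). \<exists>f\<in>X. P f}"
    if "f \<in> RM_fin A" "P f" for f
    using that equiv_class_self[OF eq] unfolding M1_def by (auto intro: quotientI)
  show "{X \<in> carrier (M1 A). \<exists>f\<in>X. P f} \<subseteq> carrier (M1 A)" by blast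
  show "\<one>\<^bsub>M1 A\<^esub> \<in> {X \<in> carrier (M1 A). \<exists>f\<in>X. P f}"
    using cls[OF id one] unfolding M1_def by simp
  fix X Y assume "X \<in> {X \<in> carrier (M1 A). \<exists>f\<in>X. P f}" "Y \<in> {X \<in> carrier (M1 A). \<exists>f\<in>X. P f}"
  then obtain f g where fg: "f \<in> RM_fin A" "P f" "X = fin_equiv A `` {f}"
    "g \<in> RM_fin A" "P g" "Y = fin_equiv A `` {g}"
    using rep by meson
  then have "X \<otimes>\<^bsub>M1 A\<^esub> Y = fin_equiv A `` {f \<circ>\<^sub>m g}" using M1_mult[OF A] by simp
  then show "X \<otimes>\<^bsub>M1 A\<^esub> Y \<in> {X \<in> carrier (M1 A). \<exists>f\<in>X. P f}"
    using cls[OF RM_fin_comp[OF A fg(1,4)] comp[OF fg(1,4,2,5)]] by simp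
qed

lemma submonoid_plep_carrier:
  assumes A: "finite A"
  shows "submonoid (plep_carrier A) (M1 A)"
  unfolding plep_carrier_def
proof (rule M1_submonoidI[OF A])
  show "plep (Some |` lists A)" unfolding plep_def by auto
  fix f g :: "'a list \<rightharpoonup> 'a list" assume f: "plep f" and g: "plep g"
  have dom: "\<exists>y z. g x = Some y \<and> f y = Some z \<and> (f \<circ>\<^sub>m g) x = Some z" if "x \<in> dom (f \<circ>\<^sub>m g)" for x
    using that by (auto simp: map_comp_def split: option.splits)
  have "length (the ((f \<circ>\<^sub>m g) x)) = length (the ((f \<circ>\<^sub>m g) x'))"
    if x: "x \<in> dom (f \<circ>\<^sub>m g)" and x': "x' \<in> dom (f \<circ>\<^sub>m g)" and l: "length x = length x'" for x x'
  proof -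
    obtain y z where y: "g x = Some y" "f y = Some z" "(f \<circ>\<^sub>m g) x = Some z"
      using dom[OF x] by blast
    obtain y' z' where y': "g x' = Some y'" "f y' = Some z'" "(f \<circ>\<^sub>m g) x' = Some z'"
      using dom[OF x'] by blast
    have "length y = length y'" using g l y(1) y'(1) unfolding plep_def by (metis domI option.sel)
    then have "length z = length z'" using f y(2) y'(2) unfolding plep_def by (metis domI option.sel)
    then show ?thesis using y(3) y'(3) by simp
  qed
  then show "plep (f \<circ>\<^sub>m g)" unfolding plep_def by blast
qed

lemma submonoid_tot_carrier:
  assumes A: "finite A" "A \<noteq> {}"
  shows "submonoid (tot_carrier A) (M1 A)"
  unfolding tot_carrier_def
proof (rule M1_submonoidI[OF A(1)])
  show "maximal_prefix_code A (domC A (Some |` lists A))"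
    unfolding tot_iff[OF A RM_fin_id[OF A(1)]] by auto
  fix f g assume f: "f \<in> RM_fin A" and g: "g \<in> RM_fin A"
    and mf: "maximal_prefix_code A (domC A f)" and mg: "maximal_prefix_code A (domC A g)"
  obtain N where N: "\<And>x. x \<in> lists A \<Longrightarrow> N \<le> length x \<Longrightarrow> x \<in> dom f"
    using mf unfolding tot_iff[OF A f] by blast
  obtain M where M: "\<And>x. x \<in> lists A \<Longrightarrow> M \<le> length x \<Longrightarrow> x \<in> dom g"
    using mg unfolding tot_iff[OF A g] by blast
  obtain L where L: "\<And>x y. g x = Some y \<Longrightarrow> length x \<le> L + length y"
    using RM_fin_length[OF A(1) g] by blast
  have "x \<in> dom (f \<circ>\<^sub>m g)" if x: "x \<in> lists A" "M + L + N \<le> length x" for x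
  proof -
    obtain y where y: "g x = Some y" using M x by fastforce
    have "y \<in> lists A" by (rule RM_fin_lists(2)[OF A(1) g y])
    moreover have "N \<le> length y" using L[OF y] x by simp
    ultimately have "y \<in> dom f" by (rule N)
    then show ?thesis using y by (auto simp: map_comp_def)
  qed
  then show "maximal_prefix_code A (domC A (f \<circ>\<^sub>m g))"
    unfolding tot_iff[OF A RM_fin_comp[OF A(1) f g]] by blast
qed

end

theory Submission
  imports Defs
begin

text \<open>
  The obstruction is a zero next to an element of infinite order. Both \<open>M1 A\<close> and \<open>plepM1 A\<close>
  contain the empty morphism \<open>0\<close>, which satisfies \<open>0 \<sigma> = 0\<close> for every \<open>\<sigma>\<close>, and the
  morphism \<open>\<sigma>: x \<mapsto> a x\<close>, whose powers \<open>x \<mapsto> a\<^sup>n x\<close> are pairwise inequivalent. Both are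
  \<open>plep\<close>: the empty morphism vacuously, and \<open>\<sigma>\<close> because it lengthens every word by one.

  Suppose that \<open>\<phi>\<close> is an injective homomorphism into \<open>totM1 B\<close>, and let \<open>g\<close> and \<open>f\<close>
  represent \<open>\<phi> 0\<close> and \<open>\<phi> \<sigma>\<close>. Then \<open>g \<circ> f\<close> agrees with \<open>g\<close> on all long words, and so the
  points \<open>x, f x, f (f x), \<dots>\<close> all lie in the fibre of \<open>g\<close> over \<open>g x\<close>; totality of \<open>f\<close> and
  \<open>g\<close> guarantees that these points exist. A right-ideal morphism with finite domain code
  replaces a prefix of bounded length, so its fibres have at most \<open>K\<close> elements for a fixed \<open>K\<close>
  (\<open>RM_fin_fibres_bounded\<close>). Hence all these orbits are eventually periodic with a common
  preperiod \<open>K\<close> and a common period \<open>K!\<close> (\<open>funpow_periodic_of_card_le\<close>), that is,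
  \<open>(\<phi> \<sigma>)\<^sup>K\<^sup>+\<^sup>K\<^sup>! = (\<phi> \<sigma>)\<^sup>K\<close> (\<open>totM1_torsion_of_left_absorbing\<close>). This contradicts the
  injectivity of \<open>\<phi>\<close>.
\<close>

section \<open>Orbits trapped in a bounded set\<close>

text \<open>
  The preperiod \<open>K\<close> and the period \<open>fact K\<close> depend on the size of \<open>S\<close> alone, so one equation
  between powers of \<open>F\<close> serves all starting points \<open>x\<close> whose sets \<open>S\<close> have at most \<open>K\<close> elements.
\<close>

lemma funpow_periodic_of_card_le:
  fixes F :: "'c \<Rightarrow> 'c"
  assumes S: "finite S" "card S \<le> K" and orbit: "\<And>i. i \<le> K \<Longrightarrow> (F ^^ i) x \<in> S"
  shows "(F ^^ (K + fact K)) x = (F ^^ K) x"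
proof -
  have "card ((\<lambda>i. (F ^^ i) x) ` {..K}) \<le> card S"
    using S(1) orbit by (intro card_mono) auto
  then have "\<not> inj_on (\<lambda>i. (F ^^ i) x) {..K}"
    using S(2) by (intro pigeonhole) simp
  then obtain i j where ij: "i < j" "j \<le> K" "(F ^^ i) x = (F ^^ j) x"
    unfolding inj_on_def by (metis atMost_iff linorder_neqE_nat)
  define d where "d = j - i"
  have period: "(F ^^ (n + d)) x = (F ^^ n) x" if "i \<le> n" for n
  proof -
    have "(F ^^ (n + d)) x = (F ^^ (n - i)) ((F ^^ j) x)"
      using ij(1) that unfolding d_def by (simp flip: funpow_add comp_apply[of "F ^^ _"])
    also have "\<dots> = (F ^^ n) x"
      using that unfolding ij(3)[symmetric] by (simp flip: funpow_add comp_apply[of "F ^^ _"])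
    finally show ?thesis .
  qed
  have multiple: "(F ^^ (K + m * d)) x = (F ^^ K) x" for m
  proof (induction m)
    case (Suc m)
    then show ?case using period[of "K + m * d"] ij by (simp add: ac_simps)
  qed simp
  have "d dvd fact K" using ij unfolding d_def by (intro dvd_fact) auto
  then obtain m where "fact K = m * d" by (metis dvd_def mult.commute)
  then show ?thesis using multiple by simp
qed

text \<open>
  If \<open>dom g\<close> is closed under truncation to length \<open>N\<close> and \<open>g y = w\<close>, then
  \<open>w = g (take N y) @ drop N y\<close>. Thus \<open>take N y\<close> and \<open>w\<close> determine \<open>y\<close>, and \<open>take N y\<close> has only
  finitely many possible values.
\<close>

lemma RM_fin_fibres_bounded:
  assumes A: "finite A" and g: "g \<in> RM_fin A"
  shows "\<exists>K. \<forall>w. finite {y. g y = Some w} \<and> card {y. g y = Some w} \<le> K"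
proof -
  obtain N where N: "\<And>x y. g x = Some y \<Longrightarrow> take N x \<in> dom g"
    using RM_fin_length[OF A g] by blast
  define P where "P = {p. set p \<subseteq> A \<and> length p \<le> N}"
  have P: "finite P" unfolding P_def by (rule finite_lists_length_le[OF A])
  have "finite {y. g y = Some w} \<and> card {y. g y = Some w} \<le> card P" for w
  proof -
    have split: "w = the (g (take N y)) @ drop N y" if y: "g y = Some w" for y
    proof -
      obtain v where v: "g (take N y) = Some v" using N[OF y] by blast
      have "drop N y \<in> lists A" using RM_fin_lists(1)[OF A g y] by (auto dest: in_set_dropD)
      then show ?thesis using RM_fin_append[OF A g v, of "drop N y"] y v by simp
    qed
    have inj: "inj_on (take N) {y. g y = Some w}"
    proof (rule inj_onI)
      fix y y' assume "y \<in> {y. g y = Some w}" "y' \<in> {y. g y = Some w}" and t: "take N y = take N y'"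
      then have "drop N y = drop N y'" using split[of y] split[of y'] by simp
      then show "y = y'" using t by (metis append_take_drop_id)
    qed
    have img: "take N ` {y. g y = Some w} \<subseteq> P"
      using RM_fin_lists(1)[OF A g] unfolding P_def by (auto dest!: in_set_takeD)
    show ?thesis
      using inj img P by (metis card_inj_on_le inj_on_finite)
  qed
  then show ?thesis by blast
qed

section \<open>Powers in the monoid of right-ideal morphisms\<close>

primrec map_pow :: "'a set \<Rightarrow> ('a list \<rightharpoonup> 'a list) \<Rightarrow> nat \<Rightarrow> ('a list \<rightharpoonup> 'a list)" where
  "map_pow A f 0 = Some |` lists A"
| "map_pow A f (Suc n) = map_pow A f n \<circ>\<^sub>m f"

lemma map_pow_RM_fin: "finite A \<Longrightarrow> f \<in> RM_fin A \<Longrightarrow> map_pow A f n \<in> RM_fin A"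
  by (induction n) (simp_all add: RM_fin_id RM_fin_comp)

lemma M1_nat_pow:
  assumes A: "finite A" and f: "f \<in> RM_fin A"
  shows "(fin_equiv A `` {f}) [^]\<^bsub>M1 A\<^esub> (n::nat) = fin_equiv A `` {map_pow A f n}"
proof (induction n)
  case 0
  show ?case by (simp add: nat_pow_def M1_def)
next
  case (Suc n)
  then show ?case
    using M1_mult[OF A map_pow_RM_fin[OF A f] f, of n] by (simp add: nat_pow_def)
qed

lemma fin_equiv_class_eq_iff:
  assumes A: "finite A" and f: "f \<in> RM_fin A" and g: "g \<in> RM_fin A"
  shows "fin_equiv A `` {f} = fin_equiv A `` {g} \<longleftrightarrow> (\<exists>N. \<forall>x. N \<le> length x \<longrightarrow> f x = g x)"
  using eq_equiv_class_iff[OF equiv_fin_equiv[OF A] f g] f g by (simp add: fin_equiv_iff[OF A])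

lemma fin_equiv_class_tot_rep:
  assumes A: "finite A" "A \<noteq> {}" and X: "X \<in> carrier (totM1 A)"
  obtains f N where "f \<in> RM_fin A" "X = fin_equiv A `` {f}"
    "\<And>x. x \<in> lists A \<Longrightarrow> N \<le> length x \<Longrightarrow> x \<in> dom f"
proof -
  obtain f f' where f': "X = fin_equiv A `` {f'}" and f: "f \<in> X" "maximal_prefix_code A (domC A f)"
    using X unfolding totM1_def tot_carrier_def M1_def quotient_def by auto
  have "(f', f) \<in> fin_equiv A" using f' f by blast
  then have RM: "f \<in> RM_fin A" and "X = fin_equiv A `` {f}"
    using f' equiv_class_eq[OF equiv_fin_equiv[OF A(1)]] unfolding fin_equiv_def by auto
  then show thesis using that f(2) unfolding tot_iff[OF A RM] by blast
qed

section \<open>Torsion of absorbed elements\<close>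

text \<open>
  The iterates of a total \<open>f\<close> shorten a word by at most \<open>L\<close> letters each, so for a word that
  is long enough they are defined and remain long, and the total function \<open>the \<circ> f\<close> can stand in
  for \<open>f\<close>. If in addition \<open>g \<circ> f\<close> agrees with \<open>g\<close> on long words, then \<open>g\<close> is constant along the
  orbit.
\<close>

lemma map_pow_long_words:
  assumes A: "finite A" and f: "f \<in> RM_fin A"
    and len: "\<And>x y. f x = Some y \<Longrightarrow> length x \<le> L + length y"
    and def: "\<And>x. x \<in> lists A \<Longrightarrow> N \<le> length x \<Longrightarrow> x \<in> dom f"
    and abs: "\<And>x. N \<le> length x \<Longrightarrow> (g \<circ>\<^sub>m f) x = g x"
    and x: "x \<in> lists A" "N + n * L \<le> length x"
  shows "map_pow A f n x = Some (((the \<circ> f) ^^ n) x) \<and> g (((the \<circ> f) ^^ n) x) = g x"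
  using x
proof (induction n arbitrary: x)
  case 0
  then show ?case by simp
next
  case (Suc n)
  obtain y where y: "f x = Some y" using def[of x] Suc.prems by fastforce
  have "y \<in> lists A" by (rule RM_fin_lists(2)[OF A f y])
  moreover have "N + n * L \<le> length y" using len[OF y] Suc.prems by simp
  ultimately have IH: "map_pow A f n y = Some (((the \<circ> f) ^^ n) y) \<and> g (((the \<circ> f) ^^ n) y) = g y"
    by (rule Suc.IH)
  have "g y = g x" using abs[of x] Suc.prems y by (simp add: map_comp_def)
  then show ?case using IH y by (simp del: funpow.simps add: funpow_Suc_right map_comp_def comp_def)
qed

text \<open>
  Absorption \<open>Z X = Z\<close> traps every orbit of \<open>X\<close> in a fibre of \<open>Z\<close>, and the uniform bound on the
  fibres makes all orbits eventually periodic at once. Totality is essential here: in \<open>M1 B\<close> the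
  zero absorbs everything, because the fibres of \<open>Z\<close> say nothing about points outside its domain.
\<close>

lemma totM1_torsion_of_left_absorbing:
  assumes B: "finite B" "B \<noteq> {}"
    and Z: "Z \<in> carrier (totM1 B)" and X: "X \<in> carrier (totM1 B)"
    and abs: "Z \<otimes>\<^bsub>M1 B\<^esub> X = Z"
  shows "\<exists>m n::nat. m < n \<and> X [^]\<^bsub>M1 B\<^esub> m = X [^]\<^bsub>M1 B\<^esub> n"
proof -
  obtain g N1 where g: "g \<in> RM_fin B" "Z = fin_equiv B `` {g}"
    and N1: "\<And>x. x \<in> lists B \<Longrightarrow> N1 \<le> length x \<Longrightarrow> x \<in> dom g"
    using fin_equiv_class_tot_rep[OF B Z] by blast
  obtain f N2 where f: "f \<in> RM_fin B" "X = fin_equiv B `` {f}"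
    and N2: "\<And>x. x \<in> lists B \<Longrightarrow> N2 \<le> length x \<Longrightarrow> x \<in> dom f"
    using fin_equiv_class_tot_rep[OF B X] by blast
  have "fin_equiv B `` {g \<circ>\<^sub>m f} = fin_equiv B `` {g}"
    using abs M1_mult[OF B(1) g(1) f(1)] f g by simp
  then obtain N3 where N3: "\<And>x. N3 \<le> length x \<Longrightarrow> (g \<circ>\<^sub>m f) x = g x"
    unfolding fin_equiv_class_eq_iff[OF B(1) RM_fin_comp[OF B(1) g(1) f(1)] g(1)] by blast
  obtain L where L: "\<And>x y. f x = Some y \<Longrightarrow> length x \<le> L + length y"
    using RM_fin_length[OF B(1) f(1)] by blast
  obtain K where K: "\<And>w. finite {y. g y = Some w}" "\<And>w. card {y. g y = Some w} \<le> K"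
    using RM_fin_fibres_bounded[OF B(1) g(1)] by blast
  (* Each iterate costs at most L letters; K + fact K of them must stay beyond all thresholds. *)
  define N where "N = N1 + N2 + N3"
  note long = map_pow_long_words[OF B(1) f(1) L, of N g]
  have "map_pow B f K x = map_pow B f (K + fact K) x" if x: "N + (K + fact K) * L \<le> length x" for x
  proof (cases "x \<in> lists B")
    case True
    have orbit: "map_pow B f n x = Some (((the \<circ> f) ^^ n) x) \<and> g (((the \<circ> f) ^^ n) x) = g x"
      if n: "n \<le> K + fact K" for n
    proof (rule long)
      show "N + n * L \<le> length x" using mult_le_mono1[OF n, of L] x by linarith
    qed (use N2 N3 True in \<open>auto simp: N_def\<close>)
    obtain w where w: "g x = Some w" using N1[OF True] x unfolding N_def by fastforce
    have "((the \<circ> f) ^^ (K + fact K)) x = ((the \<circ> f) ^^ K) x"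
      by (rule funpow_periodic_of_card_le[OF K(1) K(2)[of w]]) (use orbit w in auto)
    then show ?thesis using orbit[of K] orbit[of "K + fact K"] by simp
  next
    (* Neither power is defined on a word that uses letters outside B. *)
    case False
    then show ?thesis
      using RM_fin_lists(1)[OF B(1) map_pow_RM_fin[OF B(1) f(1)]] by (metis not_Some_eq)
  qed
  then have "X [^]\<^bsub>M1 B\<^esub> K = X [^]\<^bsub>M1 B\<^esub> (K + fact K)"
    unfolding f(2) M1_nat_pow[OF B(1) f(1)]
      fin_equiv_class_eq_iff[OF B(1) map_pow_RM_fin[OF B(1) f(1)] map_pow_RM_fin[OF B(1) f(1)]]
    by blast
  moreover have "K < K + fact K" by simp
  ultimately show ?thesis by blast
qed

section \<open>An element of infinite order next to a zero\<close>

definition prepend :: "'a set \<Rightarrow> 'a \<Rightarrow> ('a list \<rightharpoonup> 'a list)" where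
  "prepend A a = (\<lambda>x. if x \<in> lists A then Some (a # x) else None)"

lemma prepend_RM_fin: "finite A \<Longrightarrow> a \<in> A \<Longrightarrow> prepend A a \<in> RM_fin A"
  by (auto simp: RM_fin_iff prepend_def ran_def split: if_splits intro: exI[of _ 0])

lemma empty_RM_fin: "finite A \<Longrightarrow> Map.empty \<in> RM_fin A"
  by (simp add: RM_fin_iff)

lemma map_pow_prepend:
  assumes "a \<in> A" "x \<in> lists A"
  shows "map_pow A (prepend A a) n x = Some (replicate n a @ x)"
  using assms(2)
proof (induction n arbitrary: x)
  case (Suc n)
  then show ?case
    using assms(1) Suc.IH[of "a # x"] by (simp add: map_comp_def prepend_def replicate_app_Cons_same)
qed simp

lemma prepend_powers_distinct:
  assumes A: "finite A" and a: "a \<in> A"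
    and eq: "(fin_equiv A `` {prepend A a}) [^]\<^bsub>M1 A\<^esub> (m::nat) =
      (fin_equiv A `` {prepend A a}) [^]\<^bsub>M1 A\<^esub> (n::nat)"
  shows "m = n"
proof -
  note RM = map_pow_RM_fin[OF A prepend_RM_fin[OF A a]]
  obtain N where N: "\<And>x. N \<le> length x \<Longrightarrow>
      map_pow A (prepend A a) m x = map_pow A (prepend A a) n x"
    using eq unfolding M1_nat_pow[OF A prepend_RM_fin[OF A a]] fin_equiv_class_eq_iff[OF A RM RM]
    by blast
  have "replicate N a \<in> lists A" using a by auto
  then have "replicate m a @ replicate N a = replicate n a @ replicate N a"
    using N[of "replicate N a"] map_pow_prepend[OF a] by simp
  then show ?thesis by (metis append_same_eq length_replicate)
qed

text \<open>
  The argument takes place in the submonoid generated by the zero and \<open>prepend A a\<close>, and so it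
  applies to every \<open>H\<close> that contains these two elements, in particular to \<open>carrier (M1 A)\<close> and
  \<open>plep_carrier A\<close>.
\<close>

lemma submonoid_not_embeddable_totM1:
  fixes A :: "'a set" and B :: "'b set"
  assumes A: "finite A" "a \<in> A" and B: "finite B" "B \<noteq> {}"
    and H: "submonoid H (M1 A)"
    and zero: "fin_equiv A `` {Map.empty} \<in> H"
    and prep: "fin_equiv A `` {prepend A a} \<in> H"
    and hom: "\<phi> \<in> hom ((M1 A)\<lparr>carrier := H\<rparr>) (totM1 B)"
    and one: "\<phi> \<one>\<^bsub>M1 A\<^esub> = \<one>\<^bsub>M1 B\<^esub>"
  shows "\<not> inj_on \<phi> H"
proof
  assume inj: "inj_on \<phi> H"
  let ?s = "fin_equiv A `` {prepend A a}" and ?z = "fin_equiv A `` {Map.empty}"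
  have mult: "\<phi> (X \<otimes>\<^bsub>M1 A\<^esub> Y) = \<phi> X \<otimes>\<^bsub>M1 B\<^esub> \<phi> Y" if "X \<in> H" "Y \<in> H" for X Y
    using hom that by (simp add: hom_def totM1_def)
  have carr: "\<phi> X \<in> carrier (totM1 B)" if "X \<in> H" for X
    using hom that by (auto simp: hom_def)
  have pow: "?s [^]\<^bsub>M1 A\<^esub> n \<in> H \<and> \<phi> (?s [^]\<^bsub>M1 A\<^esub> n) = \<phi> ?s [^]\<^bsub>M1 B\<^esub> n" for n :: nat
  proof (induction n)
    case 0
    show ?case using one submonoid.one_closed[OF H] by (simp add: nat_pow_def)
  next
    case (Suc n)
    then show ?case
      using mult[OF _ prep] submonoid.m_closed[OF H _ prep] by (simp add: nat_pow_def)
  qed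
  have "?z \<otimes>\<^bsub>M1 A\<^esub> ?s = ?z"
  proof -
    have "Map.empty \<circ>\<^sub>m prepend A a = Map.empty" by (simp add: map_comp_def fun_eq_iff split: option.split)
    then show ?thesis using M1_mult[OF A(1) empty_RM_fin[OF A(1)] prepend_RM_fin[OF A]] by simp
  qed
  then have "\<phi> ?z \<otimes>\<^bsub>M1 B\<^esub> \<phi> ?s = \<phi> ?z" using mult[OF zero prep] by simp
  then obtain m n :: nat where mn: "m < n" "\<phi> ?s [^]\<^bsub>M1 B\<^esub> m = \<phi> ?s [^]\<^bsub>M1 B\<^esub> n"
    using totM1_torsion_of_left_absorbing[OF B carr[OF zero] carr[OF prep]] by blast
  then have "?s [^]\<^bsub>M1 A\<^esub> m = ?s [^]\<^bsub>M1 A\<^esub> n" using pow inj by (metis inj_onD)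
  then show False using prepend_powers_distinct[OF A] mn(1) by blast
qed

theorem theorem8p1:
  fixes h k :: nat and A :: "'a set" and B :: "'b set"
  assumes "2 \<le> h" and "2 \<le> k"
    and "finite A" and "card A = h"
    and "finite B" and "card B = k"
  shows "\<not> (\<exists>\<phi> \<in> hom (M1 A) (totM1 B).
              \<phi> \<one>\<^bsub>M1 A\<^esub> = \<one>\<^bsub>totM1 B\<^esub> \<and> inj_on \<phi> (carrier (M1 A))) \<and>
         \<not> (\<exists>\<phi> \<in> hom (plepM1 A) (totM1 B).
              \<phi> \<one>\<^bsub>plepM1 A\<^esub> = \<one>\<^bsub>totM1 B\<^esub> \<and> inj_on \<phi> (carrier (plepM1 A)))"
proof -
  have B: "B \<noteq> {}" using assms by auto
  obtain a where a: "a \<in> A" using assms by fastforce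
  have carr: "fin_equiv A `` {f} \<in> carrier (M1 A)" if "f \<in> RM_fin A" for f
    using that by (simp add: M1_def quotientI)
  have plep: "fin_equiv A `` {f} \<in> plep_carrier A" if "f \<in> RM_fin A" "plep f" for f
    using that carr equiv_class_self[OF equiv_fin_equiv[OF assms(3)]]
    unfolding plep_carrier_def by blast
  note empty = empty_RM_fin[OF assms(3)] and prepend = prepend_RM_fin[OF assms(3) a]
  note no_emb = submonoid_not_embeddable_totM1[OF assms(3) a assms(5) B]
  have sub: "submonoid (carrier (M1 A)) (M1 A)"
    using monoid_M1[OF assms(3)]
    by (auto intro!: submonoid.intro simp: monoid.m_closed monoid.one_closed)
  have "plep (Map.empty :: 'a list \<rightharpoonup> 'a list)" "plep (prepend A a)"
    by (auto simp: plep_def prepend_def split: if_splits)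
  then have "\<not> inj_on \<phi> (plep_carrier A)"
    if "\<phi> \<in> hom (plepM1 A) (totM1 B)" "\<phi> \<one>\<^bsub>plepM1 A\<^esub> = \<one>\<^bsub>totM1 B\<^esub>" for \<phi>
    using no_emb[OF submonoid_plep_carrier[OF assms(3)] plep[OF empty] plep[OF prepend], of \<phi>] that
    by (simp add: plepM1_def totM1_def)
  moreover have "\<not> inj_on \<phi> (carrier (M1 A))"
    if "\<phi> \<in> hom (M1 A) (totM1 B)" "\<phi> \<one>\<^bsub>M1 A\<^esub> = \<one>\<^bsub>totM1 B\<^esub>" for \<phi>
    using no_emb[OF sub carr[OF empty] carr[OF prepend], of \<phi>] that by (simp add: totM1_def)
  ultimately show ?thesis by (auto simp: plepM1_def)
qed

end
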